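(* UCIC constructs an index code of minimum length for every single-unicast, and more generally every unicast, index coding problem with single-uniprior side information. That is, for every such problem, the set of coded symbols transmitted by UCIC is an index code $\mathcal{D}^*$ with $|\mathcal{D}^*|=\ell^*$, where $\ell^*$ is the minimum length of an index code for the problem.
   Context: Index coding problem: a server holds symbols $\mathcal{P}=\{p_1,\dots,p_k\}$, $p_j\in\mathbb{F}_2^{b}$, and broadcasts to clients $c_1,\dots,c_n$. Client $c_i$ has in its cache the has set $H_i\subset\mathcal{P}$ and wants the want set $W_i\subseteq\mathcal{P}\setminus H_i$; the server knows all these sets. An index code $\mathcal{D}$ is a collection of (scalar linear) coded symbols, i.e. linear combinations of the $p_j$, whose transmission lets every client recover its wanted symbols from $\mathcal{D}$ and its has set; its length is $\ell=|\mathcal{D}|$. $\ell^*$ is the minimum of $\ell$ over all index codes, and $\mathcal{D}^*$ denotes an index code with $|\mathcal{D}^*|=\ell^*$. Unicast: each symbol is requested by only one client (the want sets are pairwise disjoint). Single-unicast: in addition each client requests a single unique symbol, so $n=k$ and, after labelling, $W_i=\{p_i\}$ for all $i$. A unicast problem is treated by UCIC via the standard reduction to single-unicast: a client wanting several symbols is replaced by several clients with the same has set, each wanting one of these symbols. Single-uniprior side information: $|H_i|=1$ for all $i$ and $H_i\cap H_j=\emptyset$ for all $i\neq j$ (has sets of the original clients). A client is satisfied if it has recovered all its wanted symbols, and unsatisfied otherwise. $\oplus$ denotes XOR. Side-information digraph $G=(V,E)$ of a single-unicast problem: vertex $v_i$ corresponds to $c_i$ (and $p_i$); there is an arc $(v_i,v_j)$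 iff $p_j\in H_i$. IDC (instantly decodable coding) graph $K$: undirected, same vertices; $v_i,v_j$ are adjacent iff $p_i\in H_j$ and $p_j\in H_i$. UCIC (updated clique index coding) runs on top of a heuristic/approximation minimum clique partition algorithm $\mathcal{A}$ (a procedure that, given an undirected graph, returns a partition of its vertex set into disjoint cliques, aiming at few cliques); the paper puts no further restriction on $\mathcal{A}$. Input: the side-information digraph $G=(V,E)$. While $V\neq\emptyset$ do: Step 1. Form $K$ from the current $G$ and apply $\mathcal{A}$ to $K$, obtaining a partition $\mathcal{Q}=\{\mathcal{Y}_1,\dots,\mathcal{Y}_r\}$ of $V$ into disjoint cliques. Step 2. Let $\beta$ be the set of cliques $\mathcal{Y}_b\in\mathcal{Q}$ of minimum cardinality. Step 3. For each $\mathcal{Y}_b\in\beta$ and each $v_i\in V\setminus\mathcal{Y}_b$ such that $p_i\in H_j$ for all $v_j\in\mathcal{Y}_b$, count the vertices $v_m\in V\setminus\mathcal{Y}_b$, $m\ne i$, such that $p_j\in H_m$ for all $v_j\in\mathcal{Y}_b$ and $p_i\notin H_m$ (these are the unsatisfied clients that can add $p_i$ to their cache). If some pair $(\mathcal{Y}_b,p_i)$ has a positive count, a piggyback symbol is found; choose a pair maximizing the count. Step 4. If a piggyback symbol is found, transmit $p_i\oplus\bigoplus_{v_j\in\mathcal{Y}_b}p_j$ for the chosen pair. Then remove all $v_j\in\mathcal{Y}_b$ from $G$, and for each client $c_m$ counted for the chosen pair add $p_i$ to $H_m$, i.e. add the arc $(v_m,v_i)$ to $G$. Repeat the loop. Step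 5. If no piggyback symbol is found, transmit, for every $\mathcal{Y}_u\in\mathcal{Q}$, the XOR of all $p_j$ with $v_j\in\mathcal{Y}_u$, and stop. The output is the set of all transmitted coded symbols.
   Formalization: The clique partition algorithm is additionally assumed never to return two adjacent vertices as two singleton cliques; without this the claim fails, e.g. for two clients each holding what the other wants when the algorithm returns singletons (length 2 instead of 1). *)

theory Defs
  imports
    "HOL-Library.Z2"
    "HOL-Library.FuncSet"
    "HOL-Library.Disjoint_Sets"
    "HOL-Analysis.Finite_Cartesian_Product"
begin

definition index_coding_problem ::
    "'p set \<Rightarrow> 'c set \<Rightarrow> ('c \<Rightarrow> 'p set) \<Rightarrow> ('c \<Rightarrow> 'p set) \<Rightarrow> bool" where
  "index_coding_problem P C H W \<longleftrightarrow>
     finite P \<and> finite C \<and> (\<forall>c\<in>C. H c \<subseteq> P \<and> W c \<subseteq> P - H c)"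

text \<open>Symbols requested by nobody are allowed.\<close>

definition unicast :: "'c set \<Rightarrow> ('c \<Rightarrow> 'p set) \<Rightarrow> bool" where
  "unicast C W \<longleftrightarrow> disjoint_family_on W C"

definition single_unicast :: "'p set \<Rightarrow> 'c set \<Rightarrow> ('c \<Rightarrow> 'p set) \<Rightarrow> bool" where
  "single_unicast P C W \<longleftrightarrow>
     unicast C W \<and> (\<forall>c\<in>C. card (W c) = 1) \<and> (\<Union>c\<in>C. W c) = P"

definition single_uniprior :: "'c set \<Rightarrow> ('c \<Rightarrow> 'p set) \<Rightarrow> bool" where
  "single_uniprior C H \<longleftrightarrow> (\<forall>c\<in>C. card (H c) = 1) \<and> disjoint_family_on H C"

text \<open>
  A coded symbol is given by its coefficient vector over the two-element field; the symbols
  themselves range over \<^typ>\<open>bit ^ 'b\<close>.  Coefficients vanish outside \<open>P\<close>, so that distinct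
  vectors are distinct linear combinations and the length of a code is its cardinality.
\<close>

definition coded_symbols :: "'p set \<Rightarrow> ('p \<Rightarrow> bit) set" where
  "coded_symbols P = {a. \<forall>j. j \<notin> P \<longrightarrow> a j = 0}"

definition encode :: "'p set \<Rightarrow> ('p \<Rightarrow> bit ^ 'b::finite) \<Rightarrow> ('p \<Rightarrow> bit) \<Rightarrow> bit ^ 'b" where
  "encode P x a = (\<Sum>j\<in>P. a j *s x j)"

definition index_code ::
    "'b::finite itself \<Rightarrow> 'p set \<Rightarrow> 'c set \<Rightarrow> ('c \<Rightarrow> 'p set) \<Rightarrow> ('c \<Rightarrow> 'p set)
      \<Rightarrow> ('p \<Rightarrow> bit) set \<Rightarrow> bool" where
  "index_code TYPE('b) P C H W D \<longleftrightarrow>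
     D \<subseteq> coded_symbols P \<and>
     (\<forall>c\<in>C. \<forall>j\<in>W c. \<exists>dec. \<forall>x :: 'p \<Rightarrow> bit ^ 'b.
        dec (restrict (encode P x) D) (restrict x (H c)) = x j)"

definition min_code_length ::
    "'b::finite itself \<Rightarrow> 'p set \<Rightarrow> 'c set \<Rightarrow> ('c \<Rightarrow> 'p set) \<Rightarrow> ('c \<Rightarrow> 'p set) \<Rightarrow> nat" where
  "min_code_length TYPE('b) P C H W =
     (LEAST l. \<exists>D. index_code TYPE('b) P C H W D \<and> card D = l)"

text \<open>
  Reduction of a unicast problem to single-unicast: every requested symbol \<open>j\<close> gets its own
  client, labelled by \<open>j\<close> itself, which has the has set of the original requester of \<open>j\<close> and
  wants only \<open>j\<close>.  Clients, requested symbols and vertices are thereby identified; on a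
  single-unicast problem the reduction is just the labelling of the clients by their symbols.
\<close>

definition requested_symbols :: "'c set \<Rightarrow> ('c \<Rightarrow> 'p set) \<Rightarrow> 'p set" where
  "requested_symbols C W = (\<Union>c\<in>C. W c)"

definition requester :: "'c set \<Rightarrow> ('c \<Rightarrow> 'p set) \<Rightarrow> 'p \<Rightarrow> 'c" where
  "requester C W j = (THE c. c \<in> C \<and> j \<in> W c)"

definition side_info_arcs :: "'v set \<Rightarrow> ('v \<Rightarrow> 'v set) \<Rightarrow> ('v \<times> 'v) set" where
  "side_info_arcs V H = {(i, j). i \<in> V \<and> j \<in> V \<and> j \<in> H i}"

definition idc_edges :: "('v \<times> 'v) set \<Rightarrow> 'v set set" where
  "idc_edges E = {{i, j} | i j. i \<noteq> j \<and> (i, j) \<in> E \<and> (j, i) \<in> E}"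

definition simple_graph :: "'v set \<Rightarrow> 'v set set \<Rightarrow> bool" where
  "simple_graph V K \<longleftrightarrow> finite V \<and> (\<forall>e\<in>K. e \<subseteq> V \<and> card e = 2)"

definition clique :: "'v set set \<Rightarrow> 'v set \<Rightarrow> bool" where
  "clique K Y \<longleftrightarrow> (\<forall>i\<in>Y. \<forall>j\<in>Y. i \<noteq> j \<longrightarrow> {i, j} \<in> K)"

definition clique_partition :: "'v set \<Rightarrow> 'v set set \<Rightarrow> 'v set set \<Rightarrow> bool" where
  "clique_partition V K Q \<longleftrightarrow> partition_on V Q \<and> (\<forall>Y\<in>Q. clique K Y)"

definition clique_partition_algorithm :: "('v set \<Rightarrow> 'v set set \<Rightarrow> 'v set set) \<Rightarrow> bool" where
  "clique_partition_algorithm A \<longleftrightarrow>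
     (\<forall>V K. simple_graph V K \<longrightarrow> clique_partition V K (A V K))"

text \<open>
  The sense in which the algorithm aims at few cliques: it never leaves two adjacent vertices
  as two singleton cliques.  Minimum clique partitions, partitions without two mergeable
  cliques (hence greedy heuristics such as first-fit colouring of the complement graph) and
  maximal matchings all qualify; the partition into singletons in general does not.
  If the algorithm always returns singletons, the code produced for two clients, each having
  what the other one wants, has length 2 instead of 1.
\<close>

definition merges_singletons :: "('v set \<Rightarrow> 'v set set \<Rightarrow> 'v set set) \<Rightarrow> bool" where
  "merges_singletons A \<longleftrightarrow>
     (\<forall>V K u v. simple_graph V K \<and> u \<noteq> v \<and> {u} \<in> A V K \<and> {v} \<in> A V K
        \<longrightarrow> {u, v} \<notin> K)"

definition smallest_cliques :: "'v set set \<Rightarrow> 'v set set" where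
  "smallest_cliques Q = {Y \<in> Q. \<forall>Z\<in>Q. card Y \<le> card Z}"

definition new_holders :: "'v set \<Rightarrow> ('v \<times> 'v) set \<Rightarrow> 'v set \<Rightarrow> 'v \<Rightarrow> 'v set" where
  "new_holders V E Y i =
     {m \<in> V - Y. m \<noteq> i \<and> (\<forall>j\<in>Y. (m, j) \<in> E) \<and> (m, i) \<notin> E}"

definition piggyback_pairs ::
    "'v set \<Rightarrow> ('v \<times> 'v) set \<Rightarrow> 'v set set \<Rightarrow> ('v set \<times> 'v) set" where
  "piggyback_pairs V E Q =
     {(Y, i). Y \<in> smallest_cliques Q \<and> i \<in> V - Y \<and> (\<forall>j\<in>Y. (j, i) \<in> E) \<and>
        card (new_holders V E Y i) > 0}"

definition best_piggyback_pairs ::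
    "'v set \<Rightarrow> ('v \<times> 'v) set \<Rightarrow> 'v set set \<Rightarrow> ('v set \<times> 'v) set" where
  "best_piggyback_pairs V E Q =
     {(Y, i) \<in> piggyback_pairs V E Q. \<forall>(Z, l) \<in> piggyback_pairs V E Q.
        card (new_holders V E Z l) \<le> card (new_holders V E Y i)}"

definition xor_of :: "'v set \<Rightarrow> 'v \<Rightarrow> bit" where
  "xor_of Y = (\<lambda>j. of_bool (j \<in> Y))"

text \<open>
  \<open>ucic A V E D\<close>: some run on the digraph with vertices \<open>V\<close> and arcs \<open>E\<close> halts with the set
  \<open>D\<close> of transmitted coded symbols.  It is a relation because ties between best piggyback
  pairs may be broken arbitrarily.
\<close>

inductive ucic ::
    "('v set \<Rightarrow> 'v set set \<Rightarrow> 'v set set) \<Rightarrow> 'v set \<Rightarrow> ('v \<times> 'v) set \<Rightarrow> ('v \<Rightarrow> bit) set \<Rightarrow> bool"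
  for A where
  finished: "ucic A {} E {}"
| piggyback:
    "\<lbrakk>V \<noteq> {};
      (Y, i) \<in> best_piggyback_pairs V E (A V (idc_edges E));
      V' = V - Y;
      E' = (E \<union> new_holders V E Y i \<times> {i}) \<inter> V' \<times> V';
      ucic A V' E' D\<rbrakk>
     \<Longrightarrow> ucic A V E (insert (xor_of (insert i Y)) D)"
| no_piggyback:
    "\<lbrakk>V \<noteq> {}; piggyback_pairs V E (A V (idc_edges E)) = {}\<rbrakk>
     \<Longrightarrow> ucic A V E (xor_of ` A V (idc_edges E))"

definition ucic_output ::
    "('p set \<Rightarrow> 'p set set \<Rightarrow> 'p set set) \<Rightarrow> 'c set \<Rightarrow> ('c \<Rightarrow> 'p set) \<Rightarrow> ('c \<Rightarrow> 'p set)
      \<Rightarrow> ('p \<Rightarrow> bit) set \<Rightarrow> bool" where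
  "ucic_output A C H W D \<longleftrightarrow>
     (let V = requested_symbols C W
      in ucic A V (side_info_arcs V (\<lambda>j. H (requester C W j))) D)"

lemma single_unicast_imp_unicast: "single_unicast P C W \<Longrightarrow> unicast C W"
  by (simp add: single_unicast_def)

lemma ucic_output_labelled_single_unicast:
  "ucic_output A V H (\<lambda>i. {i}) D \<longleftrightarrow> ucic A V (side_info_arcs V H) D"
proof -
  have "requester V (\<lambda>i. {i}) j = j" if "j \<in> V" for j
    using that by (auto simp: requester_def)
  then have "side_info_arcs V (\<lambda>j. H (requester V (\<lambda>i. {i}) j)) = side_info_arcs V H"
    by (auto simp: side_info_arcs_def)
  then show ?thesis
    by (simp add: ucic_output_def requested_symbols_def)
qed

end

theory Submission imports Defs begin

text \<open>
  Since every has set is a singleton, each vertex of the side-information digraph has at most one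
  out-neighbour.  A clique is then a vertex or a 2-cycle, and a piggyback step bypasses a vertex
  \<open>u\<close> outside all 2-cycles: the arcs \<open>m \<rightarrow> u \<rightarrow> i\<close> become \<open>m \<rightarrow> i\<close>, which keeps out-degrees at
  most one.  A set that is acyclic afterwards remains acyclic in the old digraph when \<open>u\<close> is added
  to it.  When no piggyback symbol is left, every cycle is a 2-cycle and forms a clique, so one
  representative per clique gives an acyclic set.  Hence there is an acyclic set of vertices at
  least as large as the code, and the size of an acyclic set bounds every index code from below.
\<close>

text \<open>Acyclicity is stated through sinks: in a finite set, having no directed cycle (loops
  included) means that every nonempty subset has a sink. Both the induction over a run and the lower
  bound use it in this form.\<close>

definition acyclic_on :: "'v set \<Rightarrow> ('v \<times> 'v) set \<Rightarrow> bool" where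
  "acyclic_on S E \<longleftrightarrow> (\<forall>T\<subseteq>S. T \<noteq> {} \<longrightarrow> (\<exists>v\<in>T. \<forall>w\<in>T. (v, w) \<notin> E))"

section \<open>Cliques of the IDC graph, piggyback pairs and existence of runs\<close>

lemma simple_graph_idc_edges:
  assumes "finite V" "E \<subseteq> V \<times> V"
  shows "simple_graph V (idc_edges E)"
  using assms by (auto simp: simple_graph_def idc_edges_def)

lemma clique_partition_idc:
  assumes "clique_partition_algorithm A" "finite V" "E \<subseteq> V \<times> V"
  shows "clique_partition V (idc_edges E) (A V (idc_edges E))"
  using assms simple_graph_idc_edges unfolding clique_partition_algorithm_def by blast

lemma clique_idc_arc:
  assumes "clique (idc_edges E) Y" "i \<in> Y" "j \<in> Y" "i \<noteq> j"
  shows "(i, j) \<in> E"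
proof -
  have "{i, j} \<in> idc_edges E"
    using assms by (simp add: clique_def)
  then show ?thesis
    by (auto simp: idc_edges_def doubleton_eq_iff)
qed

lemma best_piggyback_pairs_subset: "best_piggyback_pairs V E Q \<subseteq> piggyback_pairs V E Q"
  by (auto simp: best_piggyback_pairs_def)

lemma piggyback_pairsD:
  assumes "(Y, i) \<in> piggyback_pairs V E Q"
  shows "Y \<in> Q" "i \<in> V" "i \<notin> Y" "\<And>j. j \<in> Y \<Longrightarrow> (j, i) \<in> E"
  using assms by (auto simp: piggyback_pairs_def smallest_cliques_def)

text \<open>Keeps a run from getting stuck: there are finitely many candidate pairs, so one of them
  attains the maximal count.\<close>

lemma best_piggyback_pairs_nonempty:
  assumes "finite V" "partition_on V Q" "piggyback_pairs V E Q \<noteq> {}"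
  shows "best_piggyback_pairs V E Q \<noteq> {}"
proof -
  let ?P = "piggyback_pairs V E Q"
  let ?g = "\<lambda>(Y, i). card (new_holders V E Y i)"
  have "finite Q"
    using assms(1,2) by (rule finite_elements)
  moreover have "?P \<subseteq> Q \<times> V"
    by (auto simp: piggyback_pairs_def smallest_cliques_def)
  ultimately have fin: "finite ?P"
    using assms(1) by (meson finite_SigmaI finite_subset)
  then have "Max (?g ` ?P) \<in> ?g ` ?P"
    using assms(3) by (intro Max_in) auto
  then obtain Y i where "(Y, i) \<in> ?P" "Max (?g ` ?P) = ?g (Y, i)"
    by auto
  moreover have "?g p \<le> Max (?g ` ?P)" if "p \<in> ?P" for p
    using fin that by (intro Max_ge) auto
  ultimately have "(Y, i) \<in> best_piggyback_pairs V E Q"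
    unfolding best_piggyback_pairs_def by fastforce
  then show ?thesis
    by blast
qed

text \<open>Each piggyback step removes a nonempty clique, so the number of vertices drops. As
  \<open>ucic\<close> is a relation, existence of an output keeps a claim about all outputs from
  being vacuous.\<close>

lemma ucic_exists:
  assumes "clique_partition_algorithm A" "finite V" "E \<subseteq> V \<times> V"
  shows "\<exists>D. ucic A V E D"
  using assms(2,3)
proof (induction "card V" arbitrary: V E rule: less_induct)
  case less
  let ?Q = "A V (idc_edges E)"
  have part: "partition_on V ?Q"
    using clique_partition_idc[OF assms(1) less.prems] by (simp add: clique_partition_def)
  consider "V = {}" | "V \<noteq> {}" "piggyback_pairs V E ?Q = {}"
    | "V \<noteq> {}" "best_piggyback_pairs V E ?Q \<noteq> {}"
    using best_piggyback_pairs_nonempty[OF less.prems(1) part] by blast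
  then show ?case
  proof cases
    case 1
    then show ?thesis
      by (auto intro: ucic.finished)
  next
    case 2
    then show ?thesis
      using ucic.no_piggyback[of V E A] by (intro exI)
  next
    case 3
    then obtain Y i where Yi: "(Y, i) \<in> best_piggyback_pairs V E ?Q"
      by auto
    then have "(Y, i) \<in> piggyback_pairs V E ?Q"
      using best_piggyback_pairs_subset by blast
    then have "Y \<in> ?Q"
      by (rule piggyback_pairsD)
    then have "Y \<noteq> {}" "Y \<subseteq> V"
      using part by (auto simp: partition_on_def)
    then have "card (V - Y) < card V"
      using less.prems(1) by (intro psubset_card_mono) auto
    then have "\<exists>D. ucic A (V - Y) ((E \<union> new_holders V E Y i \<times> {i}) \<inter> (V - Y) \<times> (V - Y)) D"
      using less.prems(1) by (intro less.hyps) auto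
    then show ?thesis
      using ucic.piggyback[of V Y i E A, OF 3(1) Yi refl refl] by blast
  qed
qed

section \<open>Decodability of the transmitted symbols\<close>

lemma encode_xor_of:
  assumes "finite P" "Y \<subseteq> P"
  shows "encode P x (xor_of Y) = (\<Sum>j\<in>Y. x j)"
proof -
  have "encode P x (xor_of Y) = (\<Sum>j\<in>P. if j \<in> Y then x j else 0)"
    unfolding encode_def xor_of_def by (intro sum.cong) (auto simp: vec_eq_iff)
  also have "\<dots> = (\<Sum>j\<in>Y. x j)"
    using assms by (simp add: sum.inter_restrict[symmetric] Int_absorb1)
  finally show ?thesis .
qed

text \<open>Decoding a single XOR: whoever knows all summands but one obtains the last.\<close>

lemma sum_zero_imp_term_zero:
  fixes z :: "'a \<Rightarrow> 'b::comm_monoid_add"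
  assumes "finite Y" "v \<in> Y" "\<And>w. w \<in> Y \<Longrightarrow> w \<noteq> v \<Longrightarrow> z w = 0" "(\<Sum>j\<in>Y. z j) = 0"
  shows "z v = 0"
proof -
  have "(\<Sum>j\<in>Y. z j) = z v + (\<Sum>j\<in>Y - {v}. z j)"
    using assms(1,2) by (rule sum.remove)
  then show ?thesis
    using assms(3,4) by simp
qed

lemma ucic_subset_coded_symbols:
  assumes "ucic A V E D" "clique_partition_algorithm A" "finite V" "E \<subseteq> V \<times> V" "V \<subseteq> P"
  shows "D \<subseteq> coded_symbols P"
  using assms(1,3-)
proof (induction rule: ucic.induct)
  case (finished E)
  then show ?case
    by simp
next
  case (piggyback V Y i E V' E' D)
  have "partition_on V (A V (idc_edges E))"
    using clique_partition_idc[OF assms(2) piggyback.prems(1,2)]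
    by (simp add: clique_partition_def)
  moreover have "(Y, i) \<in> piggyback_pairs V E (A V (idc_edges E))"
    using piggyback.hyps best_piggyback_pairs_subset by blast
  ultimately have "insert i Y \<subseteq> P"
    using piggyback.prems(3) piggyback_pairsD(1,2) by (fastforce simp: partition_on_def)
  then have "xor_of (insert i Y) \<in> coded_symbols P"
    by (auto simp: xor_of_def coded_symbols_def)
  moreover have "D \<subseteq> coded_symbols P"
    using piggyback by (intro piggyback.IH) auto
  ultimately show ?case
    by simp
next
  case (no_piggyback V E)
  have "partition_on V (A V (idc_edges E))"
    using clique_partition_idc[OF assms(2) no_piggyback.prems(1,2)]
    by (simp add: clique_partition_def)
  then show ?case
    using no_piggyback.prems(3) by (auto simp: partition_on_def xor_of_def coded_symbols_def)
qed

text \<open>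
  By linearity, decodability means that a message on which the code and the side information of a
  client vanish also vanishes at the symbol that the client wants.
\<close>

lemma ucic_decodes:
  fixes z :: "'p \<Rightarrow> bit ^ 'b::finite"
  assumes "ucic A V E D" "clique_partition_algorithm A" "finite P" "V \<subseteq> P" "E \<subseteq> V \<times> V"
    and "\<forall>a\<in>D. encode P z a = 0"
    and "v \<in> V" "\<forall>w. (v, w) \<in> E \<longrightarrow> z w = 0"
  shows "z v = 0"
  using assms(1,4-)
proof (induction arbitrary: v rule: ucic.induct)
  case (finished E)
  then show ?case
    by simp
next
  case (piggyback V Y i E V' E' D)
  let ?Q = "A V (idc_edges E)"
  have finV: "finite V"
    using piggyback.prems(1) assms(3) finite_subset by blast
  have cp: "clique_partition V (idc_edges E) ?Q"
    using clique_partition_idc[OF assms(2) finV piggyback.prems(2)] .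
  have "(Y, i) \<in> piggyback_pairs V E ?Q"
    using piggyback.hyps best_piggyback_pairs_subset by blast
  note Yi = piggyback_pairsD[OF this]
  have clY: "clique (idc_edges E) Y" and YV: "Y \<subseteq> V"
    using cp Yi(1) by (auto simp: clique_partition_def partition_on_def)
  then have fin: "finite (insert i Y)"
    using finV finite_subset by auto
  have "insert i Y \<subseteq> P"
    using YV Yi(2) piggyback.prems(1) by auto
  then have sum0: "(\<Sum>j\<in>insert i Y. z j) = 0"
    using piggyback.prems(3) by (simp add: encode_xor_of[OF assms(3), symmetric])
  show ?case
  proof (cases "v \<in> Y")
    case True
    \<comment> \<open>The clique arcs and the choice of \<open>i\<close> put all other summands into
      the cache of \<open>v\<close>.\<close>
    have "z w = 0" if "w \<in> insert i Y" "w \<noteq> v" for w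
      using that True clique_idc_arc[OF clY] Yi(4) piggyback.prems(5) by blast
    then show ?thesis
      using sum_zero_imp_term_zero[OF fin _ _ sum0] True by blast
  next
    case False
    have "z w = 0" if "(v, w) \<in> E'" for w
    proof (cases "(v, w) \<in> E")
      case True
      then show ?thesis
        using piggyback.prems(5) by blast
    next
      case False
      \<comment> \<open>A new arc leads to \<open>i\<close> and starts at a client holding all of
        \<open>Y\<close>. That client extracts \<open>z i\<close> from the transmission, so its
        enlarged cache still vanishes.\<close>
      then have "w = i" and "\<forall>j\<in>Y. (v, j) \<in> E"
        using that piggyback.hyps(4) by (auto simp: new_holders_def)
      then have "z j = 0" if "j \<in> insert i Y" "j \<noteq> i" for j
        using that piggyback.prems(5) by blast
      then show ?thesis
        using sum_zero_imp_term_zero[OF fin _ _ sum0] \<open>w = i\<close> by blast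
    qed
    then show ?thesis
      using piggyback.prems piggyback.hyps(3,4) False by (intro piggyback.IH) auto
  qed
next
  case (no_piggyback V E)
  let ?Q = "A V (idc_edges E)"
  have finV: "finite V"
    using no_piggyback.prems(1) assms(3) finite_subset by blast
  have cp: "clique_partition V (idc_edges E) ?Q"
    using clique_partition_idc[OF assms(2) finV no_piggyback.prems(2)] .
  then obtain Y where Y: "Y \<in> ?Q" "v \<in> Y" "Y \<subseteq> V" "clique (idc_edges E) Y"
    using no_piggyback.prems(4) unfolding clique_partition_def partition_on_def by blast
  have "Y \<subseteq> P"
    using Y(3) no_piggyback.prems(1) by simp
  then have sum0: "(\<Sum>j\<in>Y. z j) = 0"
    using no_piggyback.prems(3) Y(1) by (simp add: encode_xor_of[OF assms(3), symmetric])
  have "finite Y"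
    using Y(3) finV finite_subset by blast
  then show ?case
    using sum_zero_imp_term_zero[OF _ Y(2) _ sum0] clique_idc_arc[OF Y(4) Y(2)]
      no_piggyback.prems(5) by blast
qed

section \<open>Acyclic sets in digraphs with out-degrees at most one\<close>

lemma clique_of_vertex:
  assumes "clique_partition V (idc_edges E) Q" "single_valued E" "(v, w) \<in> E" "v \<in> V"
  shows "{v} \<in> Q \<or> {v, w} \<in> Q"
proof -
  obtain Y where Y: "Y \<in> Q" "v \<in> Y" "clique (idc_edges E) Y"
    using assms(1,4) by (auto simp: clique_partition_def partition_on_def)
  have "y = w" if "y \<in> Y" "y \<noteq> v" for y
    using clique_idc_arc[OF Y(3) Y(2) that(1)] that(2) assms(2,3) by (auto dest: single_valuedD)
  then have "Y = {v} \<or> Y = {v, w}"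
    using Y(2) by blast
  then show ?thesis
    using Y(1) by auto
qed

text \<open>By \<open>clique_of_vertex\<close> the only alternative is that both vertices are
  singleton cliques, although they are adjacent. It is through the last assumption here that
  \<open>merges_singletons\<close> takes effect.\<close>

lemma two_cycle_in_partition:
  assumes "clique_partition V (idc_edges E) Q" "single_valued E"
    and "(v, w) \<in> E" "(w, v) \<in> E" "v \<noteq> w" "E \<subseteq> V \<times> V"
    and "\<And>x y. x \<noteq> y \<Longrightarrow> {x} \<in> Q \<Longrightarrow> {y} \<in> Q \<Longrightarrow> {x, y} \<notin> idc_edges E"
  shows "{v, w} \<in> Q"
proof -
  have "{v} \<in> Q \<or> {v, w} \<in> Q" "{w} \<in> Q \<or> {v, w} \<in> Q"
    using clique_of_vertex[OF assms(1,2) assms(3)] clique_of_vertex[OF assms(1,2) assms(4)]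
      assms(3,6) by (auto simp: insert_commute)
  moreover have "{v, w} \<in> idc_edges E"
    using assms(3-5) by (auto simp: idc_edges_def)
  ultimately show ?thesis
    using assms(5,7) by blast
qed

text \<open>A set \<open>T\<close> without a sink in \<open>E\<close> stays so in \<open>E'\<close>
  once \<open>u\<close> is deleted: a path \<open>v\<close>, \<open>u\<close>, \<open>i\<close> is
  replaced by the shortcut from \<open>v\<close> to \<open>i\<close>. The assumption
  \<open>(i, u) \<notin> E\<close> rules out \<open>v = i\<close>, where the shortcut would be a
  loop.\<close>

lemma acyclic_on_bypass:
  assumes "acyclic_on S E'" "S \<subseteq> V - {u}" "E \<subseteq> V \<times> V" "irrefl E" "single_valued E"
    and "(u, i) \<in> E" "(i, u) \<notin> E"
    and "E' = (E \<union> new_holders V E {u} i \<times> {i}) \<inter> (V - {u}) \<times> (V - {u})"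
  shows "acyclic_on (insert u S) E"
  unfolding acyclic_on_def
proof (intro allI impI, rule ccontr)
  fix T assume T: "T \<subseteq> insert u S" "T \<noteq> {}" and "\<not> (\<exists>v\<in>T. \<forall>w\<in>T. (v, w) \<notin> E)"
  then have out: "\<exists>w\<in>T. (v, w) \<in> E" if "v \<in> T" for v
    using that by blast
  have "T - {u} \<noteq> {}"
    using T(2) out assms(4) by (metis Diff_eq_empty_iff empty_iff insert_iff irreflD subsetD subset_singletonD)
  moreover have "T - {u} \<subseteq> S"
    using T(1) by blast
  ultimately obtain v where v: "v \<in> T - {u}" "\<forall>w\<in>T - {u}. (v, w) \<notin> E'"
    using assms(1) unfolding acyclic_on_def by blast
  obtain w where w: "w \<in> T" "(v, w) \<in> E"
    using out v(1) by blast
  \<comment> \<open>Arcs of \<open>E\<close> that avoid \<open>u\<close> survive in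
    \<open>E'\<close>, where \<open>v\<close> has no successor in \<open>T - {u}\<close>.\<close>
  have "w = u"
    using v w assms(3,8) by auto
  moreover have "\<exists>i'\<in>T. (u, i') \<in> E"
    using out w(1) \<open>w = u\<close> by blast
  then have "i \<in> T"
    using assms(5,6) by (auto dest: single_valuedD)
  moreover have "i \<noteq> u"
    using assms(4,6) by (auto simp: irrefl_def)
  moreover have "v \<noteq> i" "(v, i) \<notin> E"
    using w(2) \<open>w = u\<close> assms(5,7) \<open>i \<noteq> u\<close> by (auto dest: single_valuedD)
  ultimately have "(v, i) \<in> E'"
    using v(1) w(2) assms(3,6,8) by (auto simp: new_holders_def)
  then show False
    using v(2) \<open>i \<in> T\<close> \<open>i \<noteq> u\<close> by blast
qed

text \<open>Take one representative per clique. If some subset of them had no sink, it would contain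
  a walk \<open>v\<close>, \<open>w\<close>, \<open>i\<close>: either a 2-cycle, which is a clique
  with two representatives, or a path that makes \<open>({w}, i)\<close> a piggyback pair.\<close>

lemma no_piggyback_acyclic_set:
  assumes cp: "clique_partition V (idc_edges E) Q"
    and "finite V" "E \<subseteq> V \<times> V" "irrefl E" "single_valued E"
    and merge: "\<And>x y. x \<noteq> y \<Longrightarrow> {x} \<in> Q \<Longrightarrow> {y} \<in> Q \<Longrightarrow> {x, y} \<notin> idc_edges E"
    and "piggyback_pairs V E Q = {}"
  shows "\<exists>S\<subseteq>V. acyclic_on S E \<and> card S = card Q"
proof -
  have part: "partition_on V Q"
    using cp by (simp add: clique_partition_def)
  have disj: "Y = Z" if "Y \<in> Q" "Z \<in> Q" "x \<in> Y" "x \<in> Z" for x Y Z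
    using part that by (auto simp: partition_on_def disjoint_def)
  have sub: "Y \<subseteq> V" "Y \<noteq> {}" if "Y \<in> Q" for Y
    using part that by (auto simp: partition_on_def)
  define r where "r Y = (SOME v. v \<in> Y)" for Y :: "'a set"
  have r: "r Y \<in> Y" if "Y \<in> Q" for Y
    using sub(2)[OF that] by (simp add: r_def some_in_eq)
  have "inj_on r Q"
    using r disj by (metis inj_onI)
  then have card: "card (r ` Q) = card Q"
    by (rule card_image)
  have pair: False if "x \<in> r ` Q" "y \<in> r ` Q" "x \<noteq> y" "{x, y} \<in> Q" for x y
  proof -
    have "x = r {x, y}" "y = r {x, y}"
      using that r disj by blast+
    then show False
      using that(3) by simp
  qed
  have "acyclic_on (r ` Q) E"
    unfolding acyclic_on_def
  proof (intro allI impI, rule ccontr)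
    fix T assume T: "T \<subseteq> r ` Q" "T \<noteq> {}" and "\<not> (\<exists>v\<in>T. \<forall>w\<in>T. (v, w) \<notin> E)"
    then have out: "\<exists>w\<in>T. (v, w) \<in> E" if "v \<in> T" for v
      using that by blast
    obtain v w i where vwi: "v \<in> T" "w \<in> T" "i \<in> T" "(v, w) \<in> E" "(w, i) \<in> E"
      using out T(2) by blast
    then have ne: "v \<noteq> w" "w \<noteq> i"
      using \<open>irrefl E\<close> by (auto simp: irrefl_def)
    have "v \<noteq> i"
      using two_cycle_in_partition[OF cp \<open>single_valued E\<close> vwi(4) _ ne(1) \<open>E \<subseteq> V \<times> V\<close> merge]
        pair[of v w] vwi ne(1) T(1) by blast
    have "{w} \<in> Q"
      using clique_of_vertex[OF cp \<open>single_valued E\<close> vwi(5)] pair[of w i] vwi ne(2) T(1)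
        \<open>E \<subseteq> V \<times> V\<close> by blast
    moreover have "1 \<le> card Y" if "Y \<in> Q" for Y
      using sub[OF that] \<open>finite V\<close> by (simp add: Suc_le_eq card_gt_0_iff finite_subset)
    ultimately have "{w} \<in> smallest_cliques Q"
      by (simp add: smallest_cliques_def)
    \<comment> \<open>The only out-neighbour of \<open>v\<close> is \<open>w\<close>, which differs
      from \<open>i\<close>, so \<open>v\<close> does not hold \<open>i\<close> yet.\<close>
    moreover have "v \<in> new_holders V E {w} i"
      using vwi \<open>v \<noteq> i\<close> ne \<open>E \<subseteq> V \<times> V\<close> \<open>single_valued E\<close>
      by (auto simp: new_holders_def dest: single_valuedD)
    then have "0 < card (new_holders V E {w} i)"
      using \<open>finite V\<close> by (auto simp: card_gt_0_iff new_holders_def)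
    ultimately have "({w}, i) \<in> piggyback_pairs V E Q"
      using vwi(5) ne(2) \<open>E \<subseteq> V \<times> V\<close> by (auto simp: piggyback_pairs_def)
    then show False
      using assms(7) by blast
  qed
  moreover have "r ` Q \<subseteq> V"
    using r sub(1) by blast
  ultimately show ?thesis
    using card by blast
qed

text \<open>Each piggyback transmission is paid for by the bypassed vertex, and the final round by
  one vertex per clique. An inequality suffices, so transmissions need not be shown
  distinct.\<close>

lemma ucic_acyclic_set:
  assumes "ucic A V E D" "clique_partition_algorithm A" "merges_singletons A"
    and "finite V" "E \<subseteq> V \<times> V" "irrefl E" "single_valued E"
  shows "\<exists>S\<subseteq>V. acyclic_on S E \<and> card D \<le> card S"
  using assms(1,4-)
proof (induction rule: ucic.induct)
  case (finished E)
  then show ?case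
    by (auto simp: acyclic_on_def)
next
  case (piggyback V Y i E V' E' D)
  let ?Q = "A V (idc_edges E)"
  note prems = piggyback.prems
  have cp: "clique_partition V (idc_edges E) ?Q"
    using clique_partition_idc[OF assms(2) prems(1,2)] .
  have merge: "{x, y} \<notin> idc_edges E" if "x \<noteq> y" "{x} \<in> ?Q" "{y} \<in> ?Q" for x y
    using that assms(3) simple_graph_idc_edges[OF prems(1,2)] by (auto simp: merges_singletons_def)
  have part: "partition_on V ?Q"
    using cp by (simp add: clique_partition_def)
  have "(Y, i) \<in> piggyback_pairs V E ?Q"
    using piggyback.hyps best_piggyback_pairs_subset by blast
  note Yi = piggyback_pairsD[OF this]
  have "Y \<noteq> {}" "Y \<subseteq> V" "clique (idc_edges E) Y"
    using cp Yi(1) by (auto simp: clique_partition_def partition_on_def)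
  then obtain u where "u \<in> Y" "u \<in> V"
    by blast
  \<comment> \<open>A second member of \<open>Y\<close> would be the unique out-neighbour
    \<open>i\<close> of \<open>u\<close>, but \<open>i\<close> lies outside
    \<open>Y\<close>.\<close>
  have "y = i" if "y \<in> Y" "y \<noteq> u" for y
    using clique_idc_arc[OF \<open>clique _ Y\<close> \<open>u \<in> Y\<close>] that Yi(4)[OF \<open>u \<in> Y\<close>] prems(4)
    by (auto dest: single_valuedD)
  then have Y: "Y = {u}"
    using Yi(3) \<open>u \<in> Y\<close> by blast
  have ui: "(u, i) \<in> E" "u \<noteq> i"
    using Yi(3,4) Y by auto
  have iu: "(i, u) \<notin> E"
  proof
    assume "(i, u) \<in> E"
    then have "{u, i} \<in> ?Q"
      using two_cycle_in_partition[OF cp prems(4) ui(1) _ ui(2) prems(2) merge] by blast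
    then have "{u, i} = {u}"
      using disjointD[OF partition_onD2[OF part], of "{u, i}" "{u}"] Yi(1) Y by auto
    then show False
      using ui(2) by blast
  qed
  have V': "V' = V - {u}"
    and E': "E' = (E \<union> new_holders V E {u} i \<times> {i}) \<inter> (V - {u}) \<times> (V - {u})"
    using piggyback.hyps(3,4) Y by auto
  have "irrefl E'"
    using prems(3) by (auto simp: E' irrefl_def new_holders_def)
  \<comment> \<open>The sole arc of a new holder went to \<open>u\<close> and disappears with it;
    the arc to \<open>i\<close> takes its place.\<close>
  moreover have "single_valued E'"
    using prems(4) unfolding E' single_valued_def new_holders_def by blast
  ultimately obtain S where S: "S \<subseteq> V'" "acyclic_on S E'" "card D \<le> card S"
    using piggyback.IH prems(1) E' V' by auto
  have "acyclic_on (insert u S) E"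
    using acyclic_on_bypass[OF S(2) _ prems(2-4) ui(1) iu E'] S(1) V' by blast
  moreover have "finite S" "u \<notin> S"
    using S(1) V' prems(1) finite_subset by auto
  then have "card (insert (xor_of (insert i Y)) D) \<le> card (insert u S)"
    using S(3) card_insert_le_m1[of "Suc (card S)" D] by simp
  moreover have "insert u S \<subseteq> V"
    using S(1) V' \<open>u \<in> V\<close> by blast
  ultimately show ?case
    by blast
next
  case (no_piggyback V E)
  let ?Q = "A V (idc_edges E)"
  note prems = no_piggyback.prems
  have cp: "clique_partition V (idc_edges E) ?Q"
    using clique_partition_idc[OF assms(2) prems(1,2)] .
  have merge: "{x, y} \<notin> idc_edges E" if "x \<noteq> y" "{x} \<in> ?Q" "{y} \<in> ?Q" for x y
    using that assms(3) simple_graph_idc_edges[OF prems(1,2)] by (auto simp: merges_singletons_def)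
  obtain S where "S \<subseteq> V" "acyclic_on S E" "card S = card ?Q"
    using no_piggyback_acyclic_set[OF cp prems merge no_piggyback.hyps(2)] by blast
  moreover have "finite ?Q"
    using finite_elements[OF prems(1)] cp by (auto simp: clique_partition_def)
  then have "card (xor_of ` ?Q) \<le> card ?Q"
    by (rule card_image_le)
  ultimately show ?case
    by auto
qed

section \<open>Index codes: linearity, decoders and the lower bound\<close>

lemma card_UNIV_bit: "CARD(bit) = 2"
proof -
  have "(UNIV :: bit set) = {0, 1}"
    by (auto intro: bit.exhaust)
  moreover have "card {0, 1 :: bit} = 2"
    by simp
  ultimately show ?thesis
    by simp
qed

lemma finite_coded_symbols:
  assumes "finite P"
  shows "finite (coded_symbols P)"
proof -
  have "finite (UNIV :: bit set)"
    using card_UNIV_bit by (intro card_ge_0_finite) simp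
  then have "finite {a :: 'a \<Rightarrow> bit. \<forall>j. (j \<in> P \<longrightarrow> a j \<in> UNIV) \<and> (j \<notin> P \<longrightarrow> a j = 0)}"
    using assms by (intro finite_set_of_finite_funs)
  then show ?thesis
    by (simp add: coded_symbols_def)
qed

lemma encode_diff: "encode P (\<lambda>j. x j - y j) a = encode P x a - encode P y a"
  by (simp add: encode_def sum_subtractf vector_ssub_ldistrib)

lemma requester_eq:
  assumes "unicast C W" "c \<in> C" "j \<in> W c"
  shows "requester C W j = c"
  unfolding requester_def
  using assms by (intro the_equality) (auto simp: unicast_def disjoint_family_on_def)

text \<open>The decoder is an arbitrary function; all the lower bound needs is that equal inputs
  give equal outputs.\<close>

lemma index_code_decodes:
  fixes x y :: "'p \<Rightarrow> bit ^ 'b::finite"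
  assumes "index_code TYPE('b) P C H W D" "c \<in> C" "j \<in> W c"
    and "\<And>a. a \<in> D \<Longrightarrow> encode P x a = encode P y a" "\<And>h. h \<in> H c \<Longrightarrow> x h = y h"
  shows "x j = y j"
proof -
  obtain dec where dec: "\<And>x :: 'p \<Rightarrow> bit ^ 'b.
      dec (restrict (encode P x) D) (restrict x (H c)) = x j"
    using assms(1-3) unfolding index_code_def by blast
  have "restrict (encode P x) D = restrict (encode P y) D" "restrict x (H c) = restrict y (H c)"
    using assms(4,5) by (auto intro!: restrict_ext)
  then show ?thesis
    using dec[of x] dec[of y] by simp
qed

text \<open>Encoding is linear, so two messages that a client cannot tell apart differ by a message
  that vanishes on the code and on its cache.\<close>

lemma index_codeI:
  assumes "D \<subseteq> coded_symbols P"
    and "\<And>c j z :: 'p \<Rightarrow> bit ^ 'b::finite. c \<in> C \<Longrightarrow> j \<in> W c \<Longrightarrow> \<forall>a\<in>D. encode P z a = 0 \<Longrightarrow>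
      \<forall>h\<in>H c. z h = 0 \<Longrightarrow> z j = 0"
  shows "index_code TYPE('b) P C H W D"
  unfolding index_code_def
proof (intro conjI ballI assms(1))
  fix c j assume cj: "c \<in> C" "j \<in> W c"
  let ?view = "\<lambda>x :: 'p \<Rightarrow> bit ^ 'b. (restrict (encode P x) D, restrict x (H c))"
  have eq: "x j = y j" if "?view x = ?view y" for x y
  proof -
    have "encode P x a = encode P y a" if "a \<in> D" for a
      using \<open>?view x = ?view y\<close> that by (metis Pair_inject restrict_apply')
    moreover have "x h = y h" if "h \<in> H c" for h
      using \<open>?view x = ?view y\<close> that by (metis Pair_inject restrict_apply')
    ultimately have "x j - y j = 0"
      using cj by (intro assms(2)[where z = "\<lambda>j. x j - y j"]) (auto simp: encode_diff)
    then show ?thesis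
      by simp
  qed
  \<comment> \<open>Decode by choosing any message consistent with the view; by \<open>eq\<close>
    all of them agree at \<open>j\<close>.\<close>
  let ?dec = "\<lambda>e s. (SOME x. ?view x = (e, s)) j"
  have dec: "?dec (restrict (encode P x) D) (restrict x (H c)) = x j" for x
    by (rule eq, rule someI[of "\<lambda>y. ?view y = ?view x"]) (rule refl)
  show "\<exists>dec. \<forall>x :: 'p \<Rightarrow> bit ^ 'b. dec (restrict (encode P x) D) (restrict x (H c)) = x j"
    by (intro exI[of _ ?dec] allI dec)
qed

text \<open>
  Messages supported on an acyclic set are determined by their coded symbols: the decoder of a sink
  of the support of a difference only has zeros in its cache.
\<close>

lemma index_code_ge_acyclic_set:
  assumes code: "index_code TYPE('b::finite) P C H W D"
    and "finite P" "unicast C W"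
    and V: "V = requested_symbols C W"
    and "S \<subseteq> V" "V \<subseteq> P" "acyclic_on S (side_info_arcs V (\<lambda>j. H (requester C W j)))"
  shows "card S \<le> card D"
proof -
  let ?E = "side_info_arcs V (\<lambda>j. H (requester C W j))"
  let ?U = "UNIV :: (bit ^ 'b) set"
  have "1 < card ?U"
    using one_less_power[of "2 :: nat" "CARD('b)"] by (simp add: card_UNIV_bit)
  then have finU: "finite ?U"
    by (intro card_ge_0_finite) linarith
  have finD: "finite D"
    using code finite_coded_symbols[OF \<open>finite P\<close>] finite_subset
    by (auto simp: index_code_def)
  have finS: "finite S"
    using finite_subset[OF subset_trans[OF assms(5,6)] assms(2)] .
  \<comment> \<open>Extension by zero turns functions on \<open>S\<close> into messages supported on
    \<open>S\<close>.\<close>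
  define ext where "ext x j = (if j \<in> S then x j else 0)" for x :: "'a \<Rightarrow> bit ^ 'b" and j
  have inj: "inj_on (\<lambda>x. restrict (encode P (ext x)) D) (S \<rightarrow>\<^sub>E ?U)"
  proof (rule inj_onI, rule ccontr)
    fix x y assume xy: "x \<in> S \<rightarrow>\<^sub>E ?U" "y \<in> S \<rightarrow>\<^sub>E ?U" "x \<noteq> y"
      and enc: "restrict (encode P (ext x)) D = restrict (encode P (ext y)) D"
    define T where "T = {j \<in> S. x j \<noteq> y j}"
    have "T \<noteq> {}"
      using xy PiE_ext[OF xy(1,2)] by (auto simp: T_def)
    moreover have "T \<subseteq> S"
      by (auto simp: T_def)
    ultimately obtain v where v: "v \<in> T" "\<forall>w\<in>T. (v, w) \<notin> ?E"
      using assms(7) unfolding acyclic_on_def by blast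
    have "v \<in> V"
      using v(1) assms(5) by (auto simp: T_def)
    then obtain c where c: "c \<in> C" "v \<in> W c"
      using V by (auto simp: requested_symbols_def)
    \<comment> \<open>Outside \<open>S\<close> both messages are zero; inside \<open>S\<close>, a
      cached symbol is an out-neighbour of the sink \<open>v\<close> and so not in
      \<open>T\<close>.\<close>
    have cache: "ext x h = ext y h" if "h \<in> H c" for h
    proof (cases "h \<in> S")
      case True
      then have "(v, h) \<in> ?E"
        using that \<open>v \<in> V\<close> assms(5) requester_eq[OF assms(3) c] by (auto simp: side_info_arcs_def)
      then show ?thesis
        using v(2) True by (auto simp: T_def ext_def)
    qed (simp add: ext_def)
    have "encode P (ext x) a = encode P (ext y) a" if "a \<in> D" for a
      using enc that by (metis restrict_apply')
    then have "ext x v = ext y v"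
      using index_code_decodes[OF code c] cache by metis
    then show False
      using v(1) by (simp add: T_def ext_def)
  qed
  have "finite (D \<rightarrow>\<^sub>E ?U)"
    using finD finU by (intro finite_PiE)
  then have "card (S \<rightarrow>\<^sub>E ?U) \<le> card (D \<rightarrow>\<^sub>E ?U)"
    by (intro card_inj_on_le[OF inj]) auto
  \<comment> \<open>Counting: messages supported on \<open>S\<close> inject into tuples of coded
    symbols; the base exceeds 1, so exponents can be compared.\<close>
  then have "card ?U ^ card S \<le> card ?U ^ card D"
    using finS finD by (simp add: card_funcsetE)
  then show ?thesis
    using \<open>1 < card ?U\<close> by (rule power_le_imp_le_exp[rotated])
qed

section \<open>Optimality of every output\<close>

theorem theorem2:
  fixes P :: "'p set" and C :: "'c set" and H W :: "'c \<Rightarrow> 'p set"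
    and A :: "'p set \<Rightarrow> 'p set set \<Rightarrow> 'p set set"
  assumes "index_coding_problem P C H W"
    and "unicast C W"
    and "single_uniprior C H"
    and "clique_partition_algorithm A"
    and "merges_singletons A"
  shows "(\<exists>D. ucic_output A C H W D) \<and>
    (\<forall>D. ucic_output A C H W D \<longrightarrow>
       index_code TYPE('b::finite) P C H W D \<and>
       card D = min_code_length TYPE('b) P C H W)"
proof -
  define V where "V = requested_symbols C W"
  define E where "E = side_info_arcs V (\<lambda>j. H (requester C W j))"
  have out: "ucic_output A C H W D \<longleftrightarrow> ucic A V E D" for D
    by (simp add: ucic_output_def Let_def V_def E_def)
  have finP: "finite P" and VP: "V \<subseteq> P"
    using assms(1) by (auto simp: index_coding_problem_def V_def requested_symbols_def)
  then have finV: "finite V"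
    using finite_subset by blast
  have EV: "E \<subseteq> V \<times> V"
    by (auto simp: E_def side_info_arcs_def)
  have arcE: "\<exists>c\<in>C. v \<in> W c \<and> w \<in> H c \<and> requester C W v = c" if "(v, w) \<in> E" for v w
    using that requester_eq[OF assms(2)]
    by (auto simp: E_def side_info_arcs_def V_def requested_symbols_def)
  \<comment> \<open>A loop would be a symbol both wanted and held by one client.\<close>
  have irr: "irrefl E"
    using arcE assms(1) by (fastforce simp: irrefl_def index_coding_problem_def)
  have sv: "single_valued E"
  proof (rule single_valuedI)
    fix v w w' assume "(v, w) \<in> E" "(v, w') \<in> E"
    then obtain c where "c \<in> C" "w \<in> H c" "w' \<in> H c"
      using arcE by metis
    moreover from this have "card (H c) = 1"
      using assms(3) by (simp add: single_uniprior_def)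
    ultimately show "w = w'"
      by (auto simp: card_1_singleton_iff)
  qed
  have "index_code TYPE('b) P C H W D \<and> card D = min_code_length TYPE('b) P C H W"
    if run: "ucic A V E D" for D
  proof
    show code: "index_code TYPE('b) P C H W D"
    proof (rule index_codeI)
      show "D \<subseteq> coded_symbols P"
        using ucic_subset_coded_symbols[OF run assms(4) finV EV VP] .
      fix c j and z :: "'p \<Rightarrow> bit ^ 'b"
      assume cj: "c \<in> C" "j \<in> W c" and z: "\<forall>a\<in>D. encode P z a = 0" "\<forall>h\<in>H c. z h = 0"
      have "j \<in> V"
        using cj by (auto simp: V_def requested_symbols_def)
      moreover have "\<forall>w. (j, w) \<in> E \<longrightarrow> z w = 0"
        using z(2) requester_eq[OF assms(2) cj] by (auto simp: E_def side_info_arcs_def)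
      ultimately show "z j = 0"
        using ucic_decodes[OF run assms(4) finP VP EV z(1)] by blast
    qed
    obtain S where S: "S \<subseteq> V" "acyclic_on S E" "card D \<le> card S"
      using ucic_acyclic_set[OF run assms(4,5) finV EV irr sv] by blast
    \<comment> \<open>The acyclic set extracted from the run bounds every competing code
      \<open>D'\<close>.\<close>
    have "card D \<le> card D'" if "index_code TYPE('b) P C H W D'" for D'
      using index_code_ge_acyclic_set[OF that finP assms(2) V_def S(1) VP] S(2,3)
      by (simp add: E_def)
    then show "card D = min_code_length TYPE('b) P C H W"
      unfolding min_code_length_def using code by (intro Least_equality[symmetric]) auto
  qed
  then show ?thesis
    using out ucic_exists[OF assms(4) finV EV] by blast
qed

end
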